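(* Let $p>1$ be an integer and let $\mathfrak{g}$ be the gap-$p$ Virasoro algebra. Every irreducible Harish-Chandra $\mathfrak{g}$-module is a highest weight module, a lowest weight module, or a cuspidal module.
   Context: Fix an integer $p>1$; for $r\in\mathbb{Z}$ let $\overline{r}\in\{0,\dots,p-1\}$ be its residue modulo $p$. The gap-$p$ Virasoro algebra $\mathfrak{g}$ is the complex Lie algebra spanned by $L_m$ ($m\in\mathbb{Z}$) and central elements $C_0,\dots,C_{p-1}$, where $C_i=C_{p-i}$ for $1\le i\le p-1$ and there are no other linear relations, with brackets $$[L_m,L_n]=(n-m)L_{m+n}+\delta_{m+n,0}\tfrac{1}{12}\left(\left(\tfrac{m}{p}\right)^3-\tfrac{m}{p}\right)C_0,\quad [L_m,L_r]=rL_{m+r},\quad [L_r,L_s]=\delta_{r+s,0}\,r\,C_{\overline{r}}$$ for $m,n\in p\mathbb{Z}$ and $r,s\in\mathbb{Z}\setminus p\mathbb{Z}$. Put $\mathfrak{g}_0=\mathrm{span}_{\mathbb{C}}\{L_0,C_0,\dots,C_{p-1}\}$ and $\mathfrak{g}_{\pm}=\mathrm{span}_{\mathbb{C}}\{L_m\mid \pm m>0\}$. A $\mathfrak{g}$-module $V$ is a weight module if $\mathfrak{g}_0$ acts diagonalizably, i.e. $V=\bigoplus_{\lambda\in\mathfrak{g}_0^*}V_\lambda$ with $V_\lambda=\{v\in V\mid av=\lambda(a)v\ \forall a\in\mathfrak{g}_0\}$; $\lambda$ is a weight if $V_\lambda\ne0$. A weight module is Harish-Chandra if $\dim V_\lambda<\infty$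 for all weights $\lambda$, and cuspidal if there is a positive integer $k$ with $\dim V_\lambda<k$ for all weights $\lambda$. A highest (resp. lowest) weight module is a weight module generated by a nonzero weight vector annihilated by $\mathfrak{g}_+$ (resp. by $\mathfrak{g}_-$). *)

theory Defs
  imports Complex_Main "HOL-Library.Poly_Mapping" "HOL-Library.FuncSet"
begin

section \<open>Lie algebras and their modules\<close>

text \<open>The Lie algebra is a subspace \<open>G\<close> of an ambient vector space; only the values of the
  bracket on \<open>G\<close> matter. A module is carried by a whole type.\<close>

locale lie_algebra = vector_space scale
  for scale :: "'k::field \<Rightarrow> 'g::ab_group_add \<Rightarrow> 'g" +
  fixes G :: "'g set" and br :: "'g \<Rightarrow> 'g \<Rightarrow> 'g"
  assumes subspace_carrier: "subspace G"
    and br_closed: "x \<in> G \<Longrightarrow> y \<in> G \<Longrightarrow> br x y \<in> G"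
    and br_add_left: "x \<in> G \<Longrightarrow> y \<in> G \<Longrightarrow> z \<in> G \<Longrightarrow> br (x + y) z = br x z + br y z"
    and br_add_right: "x \<in> G \<Longrightarrow> y \<in> G \<Longrightarrow> z \<in> G \<Longrightarrow> br x (y + z) = br x y + br x z"
    and br_scale_left: "x \<in> G \<Longrightarrow> y \<in> G \<Longrightarrow> br (scale c x) y = scale c (br x y)"
    and br_scale_right: "x \<in> G \<Longrightarrow> y \<in> G \<Longrightarrow> br x (scale c y) = scale c (br x y)"
    and br_self: "x \<in> G \<Longrightarrow> br x x = 0"
    and jacobi: "x \<in> G \<Longrightarrow> y \<in> G \<Longrightarrow> z \<in> G \<Longrightarrow>
      br x (br y z) + br y (br z x) + br z (br x y) = 0"

locale lie_module =
  lie_algebra gscale G br + V: vector_space vscale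
  for gscale :: "'k::field \<Rightarrow> 'g::ab_group_add \<Rightarrow> 'g"
    and G :: "'g set"
    and br :: "'g \<Rightarrow> 'g \<Rightarrow> 'g"
    and vscale :: "'k \<Rightarrow> 'v::ab_group_add \<Rightarrow> 'v" +
  fixes act :: "'g \<Rightarrow> 'v \<Rightarrow> 'v"
  assumes act_add_right: "x \<in> G \<Longrightarrow> act x (v + w) = act x v + act x w"
    and act_scale_right: "x \<in> G \<Longrightarrow> act x (vscale c v) = vscale c (act x v)"
    and act_add_left: "x \<in> G \<Longrightarrow> y \<in> G \<Longrightarrow> act (x + y) v = act x v + act y v"
    and act_scale_left: "x \<in> G \<Longrightarrow> act (gscale c x) v = vscale c (act x v)"
    and act_br: "x \<in> G \<Longrightarrow> y \<in> G \<Longrightarrow> act (br x y) v = act x (act y v) - act y (act x v)"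

definition lie_submodule ::
    "'g set \<Rightarrow> ('k::field \<Rightarrow> 'v::ab_group_add \<Rightarrow> 'v) \<Rightarrow> ('g \<Rightarrow> 'v \<Rightarrow> 'v) \<Rightarrow> 'v set \<Rightarrow> bool"
  where "lie_submodule G vscale act W \<longleftrightarrow>
    module.subspace vscale W \<and> (\<forall>x\<in>G. \<forall>v\<in>W. act x v \<in> W)"

definition lie_irreducible ::
    "'g set \<Rightarrow> ('k::field \<Rightarrow> 'v::ab_group_add \<Rightarrow> 'v) \<Rightarrow> ('g \<Rightarrow> 'v \<Rightarrow> 'v) \<Rightarrow> bool"
  where "lie_irreducible G vscale act \<longleftrightarrow>
    (\<exists>v::'v. v \<noteq> 0) \<and> (\<forall>W. lie_submodule G vscale act W \<longrightarrow> W = {0} \<or> W = UNIV)"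

definition lie_generated_by ::
    "'g set \<Rightarrow> ('k::field \<Rightarrow> 'v::ab_group_add \<Rightarrow> 'v) \<Rightarrow> ('g \<Rightarrow> 'v \<Rightarrow> 'v) \<Rightarrow> 'v \<Rightarrow> bool"
  where "lie_generated_by G vscale act v \<longleftrightarrow>
    (\<forall>W. lie_submodule G vscale act W \<and> v \<in> W \<longrightarrow> W = UNIV)"

text \<open>The whole space is the internal direct sum of the family \<open>W\<close> of subspaces indexed by \<open>I\<close>.\<close>

definition internal_direct_sum :: "'i set \<Rightarrow> ('i \<Rightarrow> 'v::ab_group_add set) \<Rightarrow> bool"
  where "internal_direct_sum I W \<longleftrightarrow>
    (\<forall>v. \<exists>!f. (\<forall>i\<in>I. f i \<in> W i) \<and> (\<forall>i. i \<notin> I \<longrightarrow> f i = 0) \<and>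
      finite {i. f i \<noteq> 0} \<and> v = (\<Sum>i\<in>{i. f i \<noteq> 0}. f i))"

definition fin_dim :: "('k::field \<Rightarrow> 'v::ab_group_add \<Rightarrow> 'v) \<Rightarrow> 'v set \<Rightarrow> bool"
  where "fin_dim vscale W \<longleftrightarrow> (\<exists>B. finite B \<and> W \<subseteq> module.span vscale B)"


section \<open>The gap-p Virasoro algebra\<close>

datatype gv_index = L_idx int | C_idx nat

type_synonym gv = "gv_index \<Rightarrow>\<^sub>0 complex"

lift_definition gv_scale :: "complex \<Rightarrow> gv \<Rightarrow> gv" is "\<lambda>c f i. c * f i"
  by (rule finite_subset[rotated]) auto

lemma lookup_gv_scale [simp]: "Poly_Mapping.lookup (gv_scale c x) i = c * Poly_Mapping.lookup x i"
  by transfer simp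

global_interpretation gv: vector_space gv_scale
  by standard (auto intro!: poly_mapping_eqI simp: lookup_add algebra_simps)

definition gvL :: "int \<Rightarrow> gv"
  where "gvL m = Poly_Mapping.single (L_idx m) 1"

text \<open>The identification of the i-th and the (p - i)-th central element is built in by choosing
  the smaller index as representative; \<open>gvC p 0\<close> is \<open>single (C_idx 0) 1\<close>.\<close>

definition gvC :: "nat \<Rightarrow> nat \<Rightarrow> gv"
  where "gvC p i = Poly_Mapping.single (C_idx (min i (p - i))) 1"

definition gap_virasoro :: "nat \<Rightarrow> gv set"
  where "gap_virasoro p = gv.span (range gvL \<union> gvC p ` {..<p})"

text \<open>The third case is the second one with the arguments exchanged.\<close>

fun gv_bracket_basis :: "nat \<Rightarrow> gv_index \<Rightarrow> gv_index \<Rightarrow> gv" where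
  "gv_bracket_basis p (L_idx m) (L_idx n) =
    (if int p dvd m \<and> int p dvd n then
       gv_scale (of_int (n - m)) (gvL (m + n)) +
       (if m + n = 0
        then gv_scale (1 / 12 * ((of_int m / of_nat p) ^ 3 - of_int m / of_nat p)) (gvC p 0)
        else 0)
     else if int p dvd m then gv_scale (of_int n) (gvL (m + n))
     else if int p dvd n then - gv_scale (of_int m) (gvL (n + m))
     else if m + n = 0 then gv_scale (of_int m) (gvC p (nat (m mod int p)))
     else 0)"
| "gv_bracket_basis p (C_idx i) b = 0"
| "gv_bracket_basis p a (C_idx j) = 0"

definition gv_bracket :: "nat \<Rightarrow> gv \<Rightarrow> gv \<Rightarrow> gv"
  where "gv_bracket p x y = (\<Sum>a\<in>Poly_Mapping.keys x. \<Sum>b\<in>Poly_Mapping.keys y.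
    gv_scale (Poly_Mapping.lookup x a * Poly_Mapping.lookup y b) (gv_bracket_basis p a b))"

definition gv_zero :: "nat \<Rightarrow> gv set"
  where "gv_zero p = gv.span (insert (gvL 0) (gvC p ` {..<p}))"

definition gv_plus :: "gv set"
  where "gv_plus = gv.span {gvL m | m. m > 0}"

definition gv_minus :: "gv set"
  where "gv_minus = gv.span {gvL m | m. m < 0}"


subsection \<open>It is a Lie algebra with the intended basis\<close>

lemma gv_bracket_eq:
  assumes "finite A" "Poly_Mapping.keys x \<subseteq> A" "finite B" "Poly_Mapping.keys y \<subseteq> B"
  shows "gv_bracket p x y = (\<Sum>a\<in>A. \<Sum>b\<in>B.
    gv_scale (Poly_Mapping.lookup x a * Poly_Mapping.lookup y b) (gv_bracket_basis p a b))"
proof -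
  have "(\<Sum>b\<in>Poly_Mapping.keys y. gv_scale (Poly_Mapping.lookup x a * Poly_Mapping.lookup y b) (gv_bracket_basis p a b)) =
      (\<Sum>b\<in>B. gv_scale (Poly_Mapping.lookup x a * Poly_Mapping.lookup y b) (gv_bracket_basis p a b))" for a
    by (rule sum.mono_neutral_left) (use assms in \<open>auto simp: in_keys_iff\<close>)
  then have "gv_bracket p x y = (\<Sum>a\<in>Poly_Mapping.keys x. \<Sum>b\<in>B.
      gv_scale (Poly_Mapping.lookup x a * Poly_Mapping.lookup y b) (gv_bracket_basis p a b))"
    unfolding gv_bracket_def by simp
  also have "\<dots> = (\<Sum>a\<in>A. \<Sum>b\<in>B.
      gv_scale (Poly_Mapping.lookup x a * Poly_Mapping.lookup y b) (gv_bracket_basis p a b))"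
    by (rule sum.mono_neutral_left) (use assms in \<open>auto simp: in_keys_iff\<close>)
  finally show ?thesis .
qed

lemma gv_bracket_add_left: "gv_bracket p (x + y) z = gv_bracket p x z + gv_bracket p y z"
proof -
  let ?A = "Poly_Mapping.keys x \<union> Poly_Mapping.keys y"
  have "Poly_Mapping.keys (x + y) \<subseteq> ?A" by (rule Poly_Mapping.keys_add)
  then show ?thesis
    by (simp add: gv_bracket_eq[of ?A _ "Poly_Mapping.keys z"] lookup_add distrib_right
        gv.scale_left_distrib sum.distrib)
qed

lemma gv_bracket_add_right: "gv_bracket p x (y + z) = gv_bracket p x y + gv_bracket p x z"
proof -
  let ?A = "Poly_Mapping.keys y \<union> Poly_Mapping.keys z"
  have "Poly_Mapping.keys (y + z) \<subseteq> ?A" by (rule Poly_Mapping.keys_add)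
  then show ?thesis
    by (simp add: gv_bracket_eq[of "Poly_Mapping.keys x" _ ?A] lookup_add distrib_left
        gv.scale_left_distrib sum.distrib)
qed

lemma gv_bracket_scale_left: "gv_bracket p (gv_scale c x) y = gv_scale c (gv_bracket p x y)"
proof -
  have "Poly_Mapping.keys (gv_scale c x) \<subseteq> Poly_Mapping.keys x" by (auto simp: in_keys_iff)
  then show ?thesis
    by (simp add: gv_bracket_eq[of "Poly_Mapping.keys x" _ "Poly_Mapping.keys y"] gv.scale_sum_right mult.assoc)
qed

lemma gv_bracket_scale_right: "gv_bracket p x (gv_scale c y) = gv_scale c (gv_bracket p x y)"
proof -
  have "Poly_Mapping.keys (gv_scale c y) \<subseteq> Poly_Mapping.keys y" by (auto simp: in_keys_iff)
  then show ?thesis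
    by (simp add: gv_bracket_eq[of "Poly_Mapping.keys x" _ "Poly_Mapping.keys y"] gv.scale_sum_right mult.left_commute)
qed

lemma gv_bracket_zero [simp]: "gv_bracket p 0 y = 0" "gv_bracket p x 0 = 0"
  by (simp_all add: gv_bracket_def)

lemma gv_bracket_uminus [simp]:
  "gv_bracket p (- x) y = - gv_bracket p x y" "gv_bracket p x (- y) = - gv_bracket p x y"
  using gv_bracket_scale_left[of p "-1" x y] gv_bracket_scale_right[of p x "-1" y] by simp_all

lemma gv_bracket_single:
  "gv_bracket p (Poly_Mapping.single a 1) (Poly_Mapping.single b 1) = gv_bracket_basis p a b"
  by (simp add: gv_bracket_def)

lemma gv_bracket_L_L: "gv_bracket p (gvL m) (gvL n) = gv_bracket_basis p (L_idx m) (L_idx n)"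
  by (simp add: gvL_def gv_bracket_single)

lemma gv_bracket_C [simp]: "gv_bracket p (gvC q i) y = 0" "gv_bracket p x (gvC q i) = 0"
proof -
  show "gv_bracket p (gvC q i) y = 0"
    by (simp add: gv_bracket_def gvC_def)
  have "gv_bracket_basis p a (C_idx j) = 0" for a j by (cases a) auto
  then show "gv_bracket p x (gvC q i) = 0"
    by (simp add: gv_bracket_def gvC_def)
qed

lemma gvC_symmetric: "i \<le> p \<Longrightarrow> gvC p (p - i) = gvC p i"
  by (simp add: gvC_def min.commute)

lemma gv_single_eq_iff:
  "Poly_Mapping.single a (1::complex) = Poly_Mapping.single b 1 \<longleftrightarrow> a = b"
  by (metis lookup_single_eq lookup_single_not_eq zero_neq_one)

lemma gvL_eq_iff: "gvL m = gvL n \<longleftrightarrow> m = n"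
  by (simp add: gvL_def gv_single_eq_iff)

lemma gvL_neq_gvC: "gvL m \<noteq> gvC p i"
  by (simp add: gvL_def gvC_def gv_single_eq_iff)

lemma gvC_eq_iff:
  assumes "i < p" "j < p"
  shows "gvC p i = gvC p j \<longleftrightarrow> i = j \<or> i + j = p"
proof -
  have "gvC p i = gvC p j \<longleftrightarrow> min i (p - i) = min j (p - j)"
    by (simp add: gvC_def gv_single_eq_iff)
  then show ?thesis using assms by (auto simp: min_def)
qed

lemma gv_independent: "gv.independent (range gvL \<union> gvC p ` {..<p})"
proof -
  let ?e = "\<lambda>a::gv_index. Poly_Mapping.single a (1::complex)"
  have "gv.independent (range ?e)"
    unfolding gv.dependent_explicit
  proof clarify
    fix T u x
    assume T: "finite T" "T \<subseteq> range ?e" and sum0: "(\<Sum>v\<in>T. gv_scale (u v) v) = 0"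
      and x: "x \<in> T" "u x \<noteq> 0"
    obtain a where "x = ?e a" using T(2) x(1) by blast
    with x have a: "?e a \<in> T" "u (?e a) \<noteq> 0" by simp_all
    have "Poly_Mapping.lookup (gv_scale (u v) v) a = (if v = ?e a then u v else 0)" if vT: "v \<in> T" for v
    proof -
      obtain b where "v = ?e b" using T(2) vT by blast
      then show ?thesis by (cases "a = b") (auto simp: lookup_single gv_single_eq_iff)
    qed
    then have "Poly_Mapping.lookup (\<Sum>v\<in>T. gv_scale (u v) v) a = u (?e a)"
      using T(1) a(1) by (simp add: lookup_sum sum.delta)
    then show False using sum0 a(2) by simp
  qed
  then show ?thesis
    by (rule gv.independent_mono) (auto simp: gvL_def gvC_def)
qed

lemma gvL_in [simp]: "gvL m \<in> gap_virasoro p"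
  and gvC_in [simp]: "i < p \<Longrightarrow> gvC p i \<in> gap_virasoro p"
  unfolding gap_virasoro_def by (auto intro: gv.span_base)

lemma gap_virasoro_induct [consumes 1, case_names zero add scale L C]:
  assumes "x \<in> gap_virasoro p" and "P 0"
    and "\<And>x y. P x \<Longrightarrow> P y \<Longrightarrow> P (x + y)"
    and "\<And>c x. P x \<Longrightarrow> P (gv_scale c x)"
    and "\<And>m. P (gvL m)" and "\<And>i. i < p \<Longrightarrow> P (gvC p i)"
  shows "P x"
proof -
  have "gv.subspace {x. P x}" unfolding gv.subspace_def using assms(2-4) by auto
  then show ?thesis
    using assms(1,5,6) unfolding gap_virasoro_def
    by (elim gv.span_induct) (auto simp del: gvL_in gvC_in)
qed

lemma gv_subspace: "gv.subspace (gap_virasoro p)"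
  unfolding gap_virasoro_def by (rule gv.subspace_span)

lemma gv_bracket_L_L_in:
  assumes "p > 1"
  shows "gv_bracket p (gvL m) (gvL n) \<in> gap_virasoro p"
proof -
  have "nat (m mod int p) < p" using assms by (simp add: nat_less_iff)
  then show ?thesis using assms
    by (auto simp: gv_bracket_L_L intro!: gv.subspace_add[OF gv_subspace]
        gv.subspace_scale[OF gv_subspace] gv.subspace_neg[OF gv_subspace]
        gv.subspace_0[OF gv_subspace])
qed

lemma gv_bracket_in:
  assumes "p > 1" "x \<in> gap_virasoro p" "y \<in> gap_virasoro p"
  shows "gv_bracket p x y \<in> gap_virasoro p"
  using assms(2)
proof (induction rule: gap_virasoro_induct)
  case (L m)
  show ?case using assms(3)
    by (induction rule: gap_virasoro_induct)
      (use assms(1) in \<open>auto simp: gv_bracket_add_right gv_bracket_scale_right gv_bracket_L_L_in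
        intro: gv.subspace_add[OF gv_subspace] gv.subspace_scale[OF gv_subspace]
          gv.subspace_0[OF gv_subspace]\<close>)
qed (auto simp: gv_bracket_add_left gv_bracket_scale_left
      intro: gv.subspace_add[OF gv_subspace] gv.subspace_scale[OF gv_subspace]
          gv.subspace_0[OF gv_subspace])

lemma gvC_mod_minus:
  assumes "p > 1" "\<not> int p dvd m"
  shows "gvC p (nat (- m mod int p)) = gvC p (nat (m mod int p))"
proof -
  have "- m mod int p = int p - m mod int p"
    using assms by (simp add: zmod_zminus1_eq_if dvd_eq_mod_eq_0)
  moreover have "0 \<le> m mod int p" "m mod int p < int p" using assms by auto
  ultimately have "nat (- m mod int p) = p - nat (m mod int p)" "nat (m mod int p) \<le> p"
    by linarith+
  then show ?thesis by (simp add: gvC_symmetric)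
qed

lemma gv_antisym_L_L:
  assumes "p > 1"
  shows "gv_bracket p (gvL m) (gvL n) = - gv_bracket p (gvL n) (gvL m)"
proof (cases "m + n = 0")
  case True
  then have n: "n = - m" by simp
  show ?thesis
    using gvC_mod_minus[OF assms, of m]
    by (auto simp: gv_bracket_L_L n intro!: poly_mapping_eqI simp: lookup_add algebra_simps)
next
  case False
  then show ?thesis
    by (auto simp: gv_bracket_L_L add.commute intro!: poly_mapping_eqI simp: lookup_add algebra_simps)
qed

lemmas gv_bilinear = gv_bracket_add_left gv_bracket_add_right
  gv_bracket_scale_left gv_bracket_scale_right

lemma gv_antisym:
  assumes p: "p > 1" and x: "x \<in> gap_virasoro p" and y: "y \<in> gap_virasoro p"
  shows "gv_bracket p x y = - gv_bracket p y x"
proof -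
  define S where "S x y = gv_bracket p x y + gv_bracket p y x" for x y
  have linear: "S (x + x') y = S x y + S x' y" "S (gv_scale c x) y = gv_scale c (S x y)"
      "S x (y + y') = S x y + S x y'" "S x (gv_scale c y) = gv_scale c (S x y)" for x x' y y' c
    by (simp_all add: S_def gv_bilinear gv.scale_right_distrib)
  have zero: "S 0 y = 0" "S x 0 = 0" "S (gvC p i) y = 0" "S x (gvC p i) = 0" for x y i
    by (simp_all add: S_def)
  have gens: "S (gvL m) (gvL n) = 0" for m n
    unfolding S_def eq_neg_iff_add_eq_0[symmetric] by (rule gv_antisym_L_L[OF p])
  have "S x y = 0"
    using x
  proof (induction rule: gap_virasoro_induct)
    case (L m)
    show ?case using y
      by (induction rule: gap_virasoro_induct) (simp_all add: linear zero gens)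
  qed (simp_all add: linear zero)
  then show ?thesis by (simp add: S_def eq_neg_iff_add_eq_0)
qed

definition gv_jacobiator :: "nat \<Rightarrow> gv \<Rightarrow> gv \<Rightarrow> gv \<Rightarrow> gv"
  where "gv_jacobiator p x y z = gv_bracket p x (gv_bracket p y z) +
    gv_bracket p y (gv_bracket p z x) + gv_bracket p z (gv_bracket p x y)"

lemma gv_jacobiator_linear:
  "gv_jacobiator p (x + x') y z = gv_jacobiator p x y z + gv_jacobiator p x' y z"
  "gv_jacobiator p x (y + y') z = gv_jacobiator p x y z + gv_jacobiator p x y' z"
  "gv_jacobiator p x y (z + z') = gv_jacobiator p x y z + gv_jacobiator p x y z'"
  "gv_jacobiator p (gv_scale c x) y z = gv_scale c (gv_jacobiator p x y z)"
  "gv_jacobiator p x (gv_scale c y) z = gv_scale c (gv_jacobiator p x y z)"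
  "gv_jacobiator p x y (gv_scale c z) = gv_scale c (gv_jacobiator p x y z)"
  by (simp_all add: gv_jacobiator_def gv_bilinear gv.scale_right_distrib algebra_simps)

lemma gv_jacobiator_degenerate [simp]:
  "gv_jacobiator p 0 y z = 0" "gv_jacobiator p x 0 z = 0" "gv_jacobiator p x y 0 = 0"
  "gv_jacobiator p (gvC q i) y z = 0" "gv_jacobiator p x (gvC q i) z = 0"
  "gv_jacobiator p x y (gvC q i) = 0"
  by (simp_all add: gv_jacobiator_def)

lemma gv_jacobiator_rotate: "gv_jacobiator p x y z = gv_jacobiator p y z x"
  by (simp add: gv_jacobiator_def ac_simps)

lemma gv_bracket_L:
  "int p dvd m \<Longrightarrow> int p dvd n \<Longrightarrow> gv_bracket p (gvL m) (gvL n) =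
    gv_scale (of_int (n - m)) (gvL (m + n)) +
    (if m + n = 0
     then gv_scale (1 / 12 * ((of_int m / of_nat p) ^ 3 - of_int m / of_nat p)) (gvC p 0)
     else 0)"
  "int p dvd m \<Longrightarrow> \<not> int p dvd n \<Longrightarrow>
    gv_bracket p (gvL m) (gvL n) = gv_scale (of_int n) (gvL (m + n))"
  "\<not> int p dvd m \<Longrightarrow> int p dvd n \<Longrightarrow>
    gv_bracket p (gvL m) (gvL n) = - gv_scale (of_int m) (gvL (m + n))"
  "\<not> int p dvd m \<Longrightarrow> \<not> int p dvd n \<Longrightarrow> gv_bracket p (gvL m) (gvL n) =
    (if m + n = 0 then gv_scale (of_int m) (gvC p (nat (m mod int p))) else 0)"
  by (simp_all add: gv_bracket_L_L add.commute)

lemma gv_bracket_nested: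
  assumes "int p dvd m" "int p dvd n"
  shows "gv_bracket p x (gv_bracket p (gvL m) (gvL n)) =
    gv_scale (of_int (n - m)) (gv_bracket p x (gvL (m + n)))"
  using assms by (simp add: gv_bracket_L(1) gv_bracket_add_right gv_bracket_scale_right)

lemma gv_jacobi_L0:
  assumes "p > 1" "int p dvd k" "int p dvd m" "int p dvd n"
  shows "gv_jacobiator p (gvL k) (gvL m) (gvL n) = 0"
proof (rule poly_mapping_eqI)
  fix i
  have s: "int p dvd k + m" "int p dvd m + n" "int p dvd n + k" using assms by auto
  have e: "m + (n + k) = k + (m + n)" "n + (k + m) = k + (m + n)" by auto
  define f :: "int \<Rightarrow> complex"
    where "f j = 1 / 12 * ((of_int j / of_nat p) ^ 3 - of_int j / of_nat p)" for j
  define u where "u = Poly_Mapping.lookup (gvL (k + (m + n))) i"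
  define w where "w = Poly_Mapping.lookup (gvC p 0) i"
  have nested: "Poly_Mapping.lookup (gv_bracket p (gvL a) (gv_bracket p (gvL b) (gvL c))) i =
      of_int (c - b) * (of_int (b + c - a) * u + (if k + (m + n) = 0 then f a * w else 0))"
    if "int p dvd a" "int p dvd b" "int p dvd c" "a + (b + c) = k + (m + n)" for a b c
    unfolding gv_bracket_nested[OF that(2,3)] gv_bracket_L(1)[OF that(1) dvd_add[OF that(2,3)]] that(4)
    by (simp add: lookup_add u_def w_def f_def)
  have cubic: "(c - b) * (q * (a ^ 3 - a)) + (a - c) * (q * (b ^ 3 - b)) +
      (b - a) * (q * (c ^ 3 - c)) = 0" if "c = - a - b" for a b c q :: complex
    unfolding that by (simp add: power3_eq_cube algebra_simps)
  have *: "of_int (n - m) * f k + of_int (k - n) * f m + of_int (m - k) * f n = 0"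
    if "k + (m + n) = 0"
  proof -
    define x y z where "x = (of_int k / of_nat p :: complex)"
      and "y = (of_int m / of_nat p :: complex)" and "z = (of_int n / of_nat p :: complex)"
    note xyz = x_def y_def z_def
    have "n = - k - m" using that by simp
    then have "z = - x - y" by (simp add: xyz diff_divide_distrib)
    then have "of_nat p * ((z - y) * f k + (x - z) * f m + (y - x) * f n) = 0"
      using cubic[of z x y "1 / 12"] unfolding f_def xyz by simp
    moreover have "of_int (n - m) = of_nat p * (z - y)" "of_int (k - n) = of_nat p * (x - z)"
        "of_int (m - k) = of_nat p * (y - x)"
      using assms(1) by (simp_all add: xyz right_diff_distrib)
    ultimately show ?thesis by (simp only: mult.assoc flip: distrib_left)
  qed
  have "Poly_Mapping.lookup (gv_jacobiator p (gvL k) (gvL m) (gvL n)) i =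
      (if k + (m + n) = 0
       then (of_int (n - m) * f k + of_int (k - n) * f m + of_int (m - k) * f n) * w else 0)"
    unfolding gv_jacobiator_def lookup_add nested[OF assms(2-4) refl]
      nested[OF assms(3,4,2) e(1)] nested[OF assms(4,2,3) e(2)]
    by (cases "k + (m + n) = 0") (simp_all only: if_True if_False, simp_all add: algebra_simps)
  then show "Poly_Mapping.lookup (gv_jacobiator p (gvL k) (gvL m) (gvL n)) i = Poly_Mapping.lookup 0 i"
    using * by simp
qed

lemma gv_jacobi_L1:
  assumes "p > 1" "int p dvd k" "int p dvd m" "\<not> int p dvd n"
  shows "gv_jacobiator p (gvL k) (gvL m) (gvL n) = 0"
proof (rule poly_mapping_eqI)
  fix i
  have s: "int p dvd k + m" "\<not> int p dvd m + n" "\<not> int p dvd n + k"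
    using assms by (auto simp: dvd_add_right_iff dvd_add_left_iff)
  have e: "m + (n + k) = k + (m + n)" "n + (k + m) = k + (m + n)" by auto
  show "Poly_Mapping.lookup (gv_jacobiator p (gvL k) (gvL m) (gvL n)) i = Poly_Mapping.lookup 0 i"
    unfolding gv_jacobiator_def gv_bracket_nested[OF assms(2,3)]
    using s assms
    by (simp add: gv_bracket_L(2-4) gv_bracket_scale_right lookup_add e)
      (simp add: algebra_simps)
qed

lemma gv_jacobi_L2:
  assumes "p > 1" "int p dvd k" "\<not> int p dvd m" "\<not> int p dvd n"
  shows "gv_jacobiator p (gvL k) (gvL m) (gvL n) = 0"
proof -
  have s: "\<not> int p dvd k + m" "\<not> int p dvd n + k"
    using assms by (auto simp: dvd_add_right_iff dvd_add_left_iff)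
  have e: "m + (n + k) = k + (m + n)" "n + (k + m) = k + (m + n)" by auto
  have inner: "gv_bracket p (gvL k) (gv_bracket p (gvL m) (gvL n)) = 0"
    using assms by (simp add: gv_bracket_L gv_bilinear)
  show ?thesis
  proof (cases "k + (m + n) = 0")
    case True
    then have n: "n = - (m + k)" by simp
    have "gvC p (nat (n mod int p)) = gvC p (nat ((m + k) mod int p))"
      unfolding n by (rule gvC_mod_minus) (use assms s in \<open>auto simp: add.commute\<close>)
    also have "(m + k) mod int p = m mod int p" using assms(2) by auto
    finally have "gvC p (nat (n mod int p)) = gvC p (nat (m mod int p))" .
    then show ?thesis using s assms inner True
      by (simp add: gv_jacobiator_def gv_bracket_L gv_bilinear e mult.commute)
  next
    case False
    then show ?thesis using s assms inner
      by (simp add: gv_jacobiator_def gv_bracket_L gv_bilinear e)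
  qed
qed

lemma gv_jacobi_L3:
  assumes "p > 1" "\<not> int p dvd k" "\<not> int p dvd m" "\<not> int p dvd n"
  shows "gv_jacobiator p (gvL k) (gvL m) (gvL n) = 0"
  using assms by (simp add: gv_jacobiator_def gv_bracket_L gv_bilinear)

lemma gv_jacobi_L:
  assumes "p > 1"
  shows "gv_jacobiator p (gvL k) (gvL m) (gvL n) = 0"
  using gv_jacobi_L0[OF assms, of k m n] gv_jacobi_L3[OF assms, of k m n]
    gv_jacobi_L1[OF assms, of k m n] gv_jacobi_L1[OF assms, of m n k]
    gv_jacobi_L1[OF assms, of n k m]
    gv_jacobi_L2[OF assms, of k m n] gv_jacobi_L2[OF assms, of m n k]
    gv_jacobi_L2[OF assms, of n k m]
    gv_jacobiator_rotate[of p "gvL k" "gvL m" "gvL n"]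
    gv_jacobiator_rotate[of p "gvL m" "gvL n" "gvL k"]
  by metis

lemma gv_jacobi:
  assumes p: "p > 1"
    and xyz: "x \<in> gap_virasoro p" "y \<in> gap_virasoro p" "z \<in> gap_virasoro p"
  shows "gv_jacobiator p x y z = 0"
  using xyz(1)
proof (induction rule: gap_virasoro_induct)
  case (L k)
  show ?case using xyz(2)
  proof (induction rule: gap_virasoro_induct)
    case (L m)
    show ?case using xyz(3)
    proof (induction rule: gap_virasoro_induct)
      case (L n)
      show ?case by (rule gv_jacobi_L[OF p])
    qed (auto simp: gv_jacobiator_linear)
  qed (auto simp: gv_jacobiator_linear)
qed (auto simp: gv_jacobiator_linear)

lemma gap_virasoro_lie_algebra:
  assumes "p > 1"
  shows "lie_algebra gv_scale (gap_virasoro p) (gv_bracket p)"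
proof
  show "gv_bracket p x x = 0" if "x \<in> gap_virasoro p" for x
  proof -
    have "Poly_Mapping.lookup (gv_bracket p x x) i = 0" for i
      using arg_cong[OF gv_antisym[OF assms that that], of "\<lambda>f. Poly_Mapping.lookup f i"] by simp
    then show ?thesis by (intro poly_mapping_eqI) simp
  qed
  show "gv_bracket p x (gv_bracket p y z) + gv_bracket p y (gv_bracket p z x) +
      gv_bracket p z (gv_bracket p x y) = 0"
    if "x \<in> gap_virasoro p" "y \<in> gap_virasoro p" "z \<in> gap_virasoro p" for x y z
    using gv_jacobi[OF assms that] unfolding gv_jacobiator_def .
qed (simp_all only: gv_subspace gv_bracket_in[OF assms] gv_bilinear)


section \<open>Weight modules\<close>

abbreviation gv_module ::
    "nat \<Rightarrow> (complex \<Rightarrow> 'v::ab_group_add \<Rightarrow> 'v) \<Rightarrow> (gv \<Rightarrow> 'v \<Rightarrow> 'v) \<Rightarrow> bool"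
  where "gv_module p vscale act \<equiv>
    lie_module gv_scale (gap_virasoro p) (gv_bracket p) vscale act"

text \<open>The dual space of \<open>gv_zero p\<close>; extensionality makes functionals that agree on
  \<open>gv_zero p\<close> equal, so that each weight is indexed exactly once.\<close>

definition gv_zero_dual :: "nat \<Rightarrow> (gv \<Rightarrow> complex) set"
  where "gv_zero_dual p = {\<mu> \<in> extensional (gv_zero p).
    (\<forall>a\<in>gv_zero p. \<forall>b\<in>gv_zero p. \<mu> (a + b) = \<mu> a + \<mu> b) \<and>
    (\<forall>c. \<forall>a\<in>gv_zero p. \<mu> (gv_scale c a) = c * \<mu> a)}"

definition weight_space ::
    "nat \<Rightarrow> (complex \<Rightarrow> 'v::ab_group_add \<Rightarrow> 'v) \<Rightarrow> (gv \<Rightarrow> 'v \<Rightarrow> 'v) \<Rightarrow> (gv \<Rightarrow> complex) \<Rightarrow> 'v set"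
  where "weight_space p vscale act \<mu> = {v. \<forall>a\<in>gv_zero p. act a v = vscale (\<mu> a) v}"

definition weights ::
    "nat \<Rightarrow> (complex \<Rightarrow> 'v::ab_group_add \<Rightarrow> 'v) \<Rightarrow> (gv \<Rightarrow> 'v \<Rightarrow> 'v) \<Rightarrow> (gv \<Rightarrow> complex) set"
  where "weights p vscale act = {\<mu> \<in> gv_zero_dual p. weight_space p vscale act \<mu> \<noteq> {0}}"

definition weight_module ::
    "nat \<Rightarrow> (complex \<Rightarrow> 'v::ab_group_add \<Rightarrow> 'v) \<Rightarrow> (gv \<Rightarrow> 'v \<Rightarrow> 'v) \<Rightarrow> bool"
  where "weight_module p vscale act \<longleftrightarrow> gv_module p vscale act \<and>
    internal_direct_sum (gv_zero_dual p) (weight_space p vscale act)"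

definition harish_chandra ::
    "nat \<Rightarrow> (complex \<Rightarrow> 'v::ab_group_add \<Rightarrow> 'v) \<Rightarrow> (gv \<Rightarrow> 'v \<Rightarrow> 'v) \<Rightarrow> bool"
  where "harish_chandra p vscale act \<longleftrightarrow> weight_module p vscale act \<and>
    (\<forall>\<mu>\<in>weights p vscale act. fin_dim vscale (weight_space p vscale act \<mu>))"

text \<open>\<open>dim\<close> is 0 on infinite-dimensional spaces, so finite-dimensionality is required
  explicitly.\<close>

definition cuspidal ::
    "nat \<Rightarrow> (complex \<Rightarrow> 'v::ab_group_add \<Rightarrow> 'v) \<Rightarrow> (gv \<Rightarrow> 'v \<Rightarrow> 'v) \<Rightarrow> bool"
  where "cuspidal p vscale act \<longleftrightarrow> weight_module p vscale act \<and>
    (\<exists>k>0. \<forall>\<mu>\<in>weights p vscale act. fin_dim vscale (weight_space p vscale act \<mu>) \<and>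
      vector_space.dim vscale (weight_space p vscale act \<mu>) < k)"

definition highest_weight_module ::
    "nat \<Rightarrow> (complex \<Rightarrow> 'v::ab_group_add \<Rightarrow> 'v) \<Rightarrow> (gv \<Rightarrow> 'v \<Rightarrow> 'v) \<Rightarrow> bool"
  where "highest_weight_module p vscale act \<longleftrightarrow> weight_module p vscale act \<and>
    (\<exists>\<mu>\<in>gv_zero_dual p. \<exists>v\<in>weight_space p vscale act \<mu>. v \<noteq> 0 \<and>
      (\<forall>x\<in>gv_plus. act x v = 0) \<and> lie_generated_by (gap_virasoro p) vscale act v)"

definition lowest_weight_module ::
    "nat \<Rightarrow> (complex \<Rightarrow> 'v::ab_group_add \<Rightarrow> 'v) \<Rightarrow> (gv \<Rightarrow> 'v \<Rightarrow> 'v) \<Rightarrow> bool"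
  where "lowest_weight_module p vscale act \<longleftrightarrow> weight_module p vscale act \<and>
    (\<exists>\<mu>\<in>gv_zero_dual p. \<exists>v\<in>weight_space p vscale act \<mu>. v \<noteq> 0 \<and>
      (\<forall>x\<in>gv_minus. act x v = 0) \<and> lie_generated_by (gap_virasoro p) vscale act v)"

end

theory Submission
  imports Defs
begin

text \<open>Irreducibility puts all weights in one coset \<open>\<mu> + \<int>\<close>, so the module is graded, with finite-dimensional
  pieces \<open>D i\<close>. If \<open>dim (D (- i))\<close>, \<open>i > 0\<close>, exceeds the total dimension of \<open>D 0, \<dots>, D (2 p - 1)\<close>, some
  nonzero \<open>v \<in> D (- i)\<close> is killed by \<open>L i, \<dots>, L (i + 2 p - 1)\<close>, and these generate all \<open>L j\<close> with \<open>j\<close>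
  large. If nevertheless no vector is killed by all \<open>L j\<close>, \<open>j > 0\<close>, then for some \<open>m > 0\<close> and \<open>t\<close> there are
  vectors \<open>w j \<in> D j\<close>, for infinitely many \<open>j \<equiv> t\<close> modulo \<open>p\<close>, with \<open>L m (w j) \<noteq> 0\<close> and \<open>L k (w j) = 0\<close> for
  \<open>k > m\<close>; the vectors \<open>L (t - j) (w j)\<close> are then linearly independent in \<open>D t\<close>, a contradiction.
  Reversing the grading bounds the other half of the dimensions.\<close>

text \<open>Central terms occur only in \<open>[L m, L n]\<close> with \<open>m + n = 0\<close>, a case the argument never needs;
  otherwise \<open>[L m, L n] = gap_coeff p m n * L (m + n)\<close>.\<close>

definition gap_coeff :: "nat \<Rightarrow> int \<Rightarrow> int \<Rightarrow> int"
  where "gap_coeff p m n =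
    (if int p dvd m then (if int p dvd n then n - m else n)
     else if int p dvd n then - m else 0)"

section \<open>Graded modules and annihilating operators\<close>

text \<open>In the application \<open>D i\<close> is the space of weight \<mu> shifted by
  \<open>i\<close>, and \<open>L n\<close> is the action of \<open>gvL n\<close>. Forgetting the
  weights lets the reversed grading be a second instance of the same axioms.\<close>

locale graded_gap_module = vector_space scale
  for scale :: "complex \<Rightarrow> 'v::ab_group_add \<Rightarrow> 'v" +
  fixes p :: nat and D :: "int \<Rightarrow> 'v set" and L :: "int \<Rightarrow> 'v \<Rightarrow> 'v"
  assumes p_pos: "p > 0"
    and linear_L: "Vector_Spaces.linear scale scale (L n)"
    and subspace_D: "subspace (D i)"
    and L_D: "v \<in> D i \<Longrightarrow> L n v \<in> D (i + n)"
    and fin_dim_D: "fin_dim scale (D i)"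
    and D_independent: "finite I \<Longrightarrow> (\<And>i. i \<in> I \<Longrightarrow> d i \<in> D i) \<Longrightarrow> (\<Sum>i\<in>I. d i) = 0 \<Longrightarrow>
      i \<in> I \<Longrightarrow> d i = 0"
    and L_commute: "m + n \<noteq> 0 \<Longrightarrow>
      L m (L n v) = L n (L m v) + scale (of_int (gap_coeff p m n)) (L (m + n) v)"
begin

lemma L_zero [simp]: "L n 0 = 0"
  by (rule module_hom.zero[OF linear_L[unfolded linear_iff_module_hom]])

lemma L_add: "L n (v + w) = L n v + L n w"
  by (rule module_hom.add[OF linear_L[unfolded linear_iff_module_hom]])

lemma L_scale: "L n (scale c v) = scale c (L n v)"
  by (rule module_hom.scale[OF linear_L[unfolded linear_iff_module_hom]])

lemma subspace_ker_L: "subspace {v. L n v = 0}"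
  by (auto simp: subspace_def L_add L_scale)

lemma annihilator_step:
  assumes "L a v = 0" "L b v = 0" "a + b \<noteq> 0" "gap_coeff p a b \<noteq> 0"
  shows "L (a + b) v = 0"
  using L_commute[OF assms(3), of v] assms by simp

text \<open>For c \<noteq> d the bracket of \<open>L (p * c)\<close> and \<open>L (p * d)\<close> is
  a nonzero multiple of \<open>L (p * (c + d))\<close>. Every n > k * (k + 1) is a combination of k
  and k + 1 with positive coefficients, so repeated brackets reach it.\<close>

lemma annihilator_multiples:
  assumes k: "k > 0" and v: "L (int p * k) v = 0" "L (int p * (k + 1)) v = 0"
    and n: "n > k * (k + 1)"
  shows "L (int p * n) v = 0"
proof -
  have step: "L (int p * (c + d)) v = 0"
    if "L (int p * c) v = 0" "L (int p * d) v = 0" "0 < c" "0 < d" "c \<noteq> d" for c d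
    using annihilator_step[of "int p * c" v "int p * d"] that p_pos
    by (simp add: gap_coeff_def distrib_left[symmetric])
  \<comment> \<open>\<open>Suc\<close> keeps both coefficients positive. From k + (k + 1) on, the
    index exceeds k and k + 1, so the two arguments of \<open>step\<close> always differ.\<close>
  have comb: "L (int p * (int (Suc a) * k + int (Suc b) * (k + 1))) v = 0" for a b
  proof (induction a)
    case 0
    show ?case
    proof (induction b)
      case 0
      show ?case using step[OF v] k by simp
    next
      case (Suc b)
      have "int (Suc 0) * k + int (Suc b) * (k + 1) > k + 1 + int b * (k + 1)"
        using k by (simp add: algebra_simps)
      moreover have "int b * (k + 1) \<ge> 0" using k by simp
      ultimately have "int (Suc 0) * k + int (Suc b) * (k + 1) > k + 1" by linarith
      then have "L (int p * ((int (Suc 0) * k + int (Suc b) * (k + 1)) + (k + 1))) v = 0"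
        using k by (intro step[OF Suc v(2)]) auto
      then show ?case by (simp add: algebra_simps)
    qed
  next
    case (Suc a)
    have "int a * k \<ge> 0" "int b * (k + 1) \<ge> 0" using k by simp_all
    moreover have "int (Suc a) * k + int (Suc b) * (k + 1) = k + int a * k + int b * (k + 1) + k + 1"
      by (simp add: algebra_simps)
    ultimately have "int (Suc a) * k + int (Suc b) * (k + 1) > k" using k by linarith
    then have "L (int p * ((int (Suc a) * k + int (Suc b) * (k + 1)) + k)) v = 0"
      using k by (intro step[OF Suc v(1)]) auto
    then show ?case by (simp add: algebra_simps)
  qed
  \<comment> \<open>With n - 1 = q k + r one gets n = (q - r - 1) k + (r + 1) (k + 1). The first
    coefficient is positive because q \<ge> k + 1 and r < k.\<close>
  define q r where "q = (n - 1) div k" and "r = (n - 1) mod k"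
  have r: "0 \<le> r" "r < k" using k by (simp_all add: r_def)
  have "k * (k + 1) div k \<le> q" unfolding q_def using n k by (intro zdiv_mono1) auto
  then have q: "q \<ge> k + 1" using k by simp
  have "n - 1 = q * k + r" by (simp add: q_def r_def)
  then have "n = int (Suc (nat (q - r - 2))) * k + int (Suc (nat r)) * (k + 1)"
    using q r by (simp add: algebra_simps)
  then show ?thesis using comb by metis
qed

text \<open>A window of 2 p consecutive indices contains two consecutive multiples of p, so all
  large multiples of p annihilate \<open>v\<close>. Any other large index is p n + (i + s) with i +
  s in the window and prime to neither role: the bracket coefficient is i + s, nonzero since p does
  not divide it.\<close>

lemma annihilator_eventually:
  assumes i: "i > 0" and v: "\<And>q. 0 \<le> q \<Longrightarrow> q < 2 * int p \<Longrightarrow> L (i + q) v = 0"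
  obtains N where "\<And>j. j \<ge> N \<Longrightarrow> L j v = 0"
proof -
  \<comment> \<open>This is i / p rounded up, so p k and p (k + 1) both lie in the window.\<close>
  define k where "k = (i + int p - 1) div int p"
  have "int p * k + (i + int p - 1) mod int p = i + int p - 1"
    unfolding k_def by simp
  moreover have "0 \<le> (i + int p - 1) mod int p" "(i + int p - 1) mod int p < int p"
    using p_pos by simp_all
  ultimately have pk: "i \<le> int p * k" "int p * k < i + int p" by linarith+
  have k: "k > 0"
    using pk(1) i p_pos by (metis less_le_trans of_nat_0_less_iff zero_less_mult_pos)
  have mult: "L (int p * n) v = 0" if "n > k * (k + 1)" for n
    using annihilator_multiples[OF k _ _ that, of v] v[of "int p * k - i"]
      v[of "int p * (k + 1) - i"] pk by (simp add: algebra_simps)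
  have kk: "k * (k + 1) > 0" using k by simp
  show ?thesis
  proof (rule that)
    fix j assume j: "j \<ge> i + int p * (k * (k + 1) + 1)"
    define n s where "n = (j - i) div int p" and "s = (j - i) mod int p"
    have s: "0 \<le> s" "s < int p" using p_pos by (simp_all add: s_def)
    have js: "j = int p * n + (i + s)" by (simp add: n_def s_def)
    have "int p * (k * (k + 1) + 1) div int p \<le> n"
      unfolding n_def using j p_pos by (intro zdiv_mono1) auto
    then have n: "n > k * (k + 1)" using p_pos by simp
    show "L j v = 0"
    proof (cases "int p dvd j")
      case True
      then obtain c where c: "j = int p * c" by blast
      have "int p * n < int p * c" using js c i s by linarith
      then have "n < c" using p_pos by simp
      then show ?thesis using mult[of c] c n by simp
    next
      case False
      then have nd: "\<not> int p dvd i + s" using js dvd_add[of "int p" "int p * n" "i + s"] by auto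
      have "0 < int p * n" using n kk p_pos by simp
      then have "int p * n + (i + s) \<noteq> 0" using i s by linarith
      moreover have "gap_coeff p (int p * n) (i + s) \<noteq> 0"
        using nd by (auto simp: gap_coeff_def)
      moreover have "L (i + s) v = 0" using v[of s] s p_pos by simp
      ultimately show ?thesis unfolding js using annihilator_step[OF mult[OF n]] by blast
    qed
  qed
qed

section \<open>From eventual annihilation to a highest weight vector\<close>

text \<open>Each \<open>w j\<close> is moved into the single degree \<open>t\<close>, where a
  triangularity argument makes the images independent. The congruence keeps the diagonal coefficient
  nonzero: it is 2 (t - J) - m < 0 if p divides m, and -(m + J - t) < 0 otherwise.\<close>

lemma independent_degrees_finite:
  assumes "m > 0"
    and w: "\<And>j. j \<in> S \<Longrightarrow> w j \<in> D j \<and> L m (w j) \<noteq> 0 \<and> (\<forall>k>m. L k (w j) = 0)"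
    and t: "\<And>j. j \<in> S \<Longrightarrow> t < j \<and> int p dvd t - j"
  shows "finite S"
proof (rule ccontr)
  assume inf: "infinite S"
  obtain B where B: "finite B" "D t \<subseteq> span B"
    using fin_dim_D unfolding fin_dim_def by blast
  define u where "u j = L (t - j) (w j)" for j
  have uD: "u j \<in> D t" if "j \<in> S" for j
    using L_D[of "w j" j "t - j"] w[OF that] by (simp add: u_def)
  have Lu: "L (m + J - t) (u j) = scale (of_int (gap_coeff p (m + J - t) (t - j))) (L (m + (J - j)) (w j))"
    if "j \<in> S" "J \<in> S" "j \<le> J" for j J
    using L_commute[of "m + J - t" "t - j" "w j"] w[OF that(1)] t[OF that(2)] that(3) \<open>m > 0\<close>
    by (simp add: u_def)
  \<comment> \<open>\<open>L (m + J - t)\<close> separates \<open>u J\<close> from all \<open>u j\<close> with \<open>j < J\<close>.\<close>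
  have kill: "L (m + J - t) (u j) = 0" if "j \<in> S" "J \<in> S" "j < J" for j J
    using Lu[of j J] w[OF that(1)] that by simp
  have live: "L (m + J - t) (u J) \<noteq> 0" if "J \<in> S" for J
  proof -
    have "gap_coeff p (m + J - t) (t - J) \<noteq> 0"
      using t[OF that] \<open>m > 0\<close> by (auto simp: gap_coeff_def)
    then show ?thesis using Lu[OF that that] w[OF that] by simp
  qed
  \<comment> \<open>Degrees are added in increasing order, so the new operator
    \<open>L (m + b - t)\<close> kills the span of all earlier vectors but not
    \<open>u b\<close>.\<close>
  have indep: "F \<subseteq> S \<longrightarrow> independent (u ` F) \<and> card (u ` F) = card F" if "finite F" for F
    using that
  proof (induction rule: finite_linorder_max_induct)
    case (insert b A)
    show ?case
    proof
      assume S: "insert b A \<subseteq> S"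
      have "span (u ` A) \<subseteq> {v. L (m + b - t) v = 0}"
        using S insert.hyps(2) kill by (intro span_minimal subspace_ker_L) auto
      then have nin: "u b \<notin> span (u ` A)" using live S by auto
      then have "u b \<notin> u ` A" by (meson span_base)
      moreover have "b \<notin> A" using insert.hyps by auto
      ultimately show "independent (u ` insert b A) \<and> card (u ` insert b A) = card (insert b A)"
        using insert nin S by (simp add: independent_insertI)
    qed
  qed (simp add: independent_empty)
  obtain F where F: "F \<subseteq> S" "finite F" "card F = Suc (card B)"
    using infinite_arbitrarily_large[OF inf] by metis
  have "u ` F \<subseteq> span B" using uD F B by blast
  then have "card (u ` F) \<le> card B"
    using independent_span_bound[OF B(1)] indep F by blast
  then show False using indep F by simp
qed

text \<open>Without such a vector, some raising operator is nonzero on each vector killed from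
  \<open>N\<close> on, and its image is again killed from \<open>N\<close> on. This yields
  infinitely many degrees, on which the last nonvanishing operator has only finitely many possible
  indices.\<close>

lemma exists_highest_weight_vector:
  assumes v: "v \<in> D i" "v \<noteq> 0" and N: "\<And>j. j \<ge> N \<Longrightarrow> L j v = 0"
  shows "\<exists>i. \<exists>w\<in>D i. w \<noteq> 0 \<and> (\<forall>j>0. L j w = 0)"
proof (rule ccontr)
  assume none: "\<not> ?thesis"
  define good where "good j w \<longleftrightarrow> w \<in> D j \<and> w \<noteq> 0 \<and> (\<forall>k\<ge>N. L k w = 0)" for j w
  \<comment> \<open>The bound j \<ge> i leaves only finitely many elements of \<open>H\<close> at or
    below any given degree, as the final contradiction requires.\<close>
  define H where "H = {j. j \<ge> i \<and> (\<exists>w. good j w)}"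
  have up: "\<exists>j'>j. j' \<in> H" if j: "j \<in> H" for j
  proof -
    obtain w where w: "good j w" "j \<ge> i" using j by (auto simp: H_def)
    then obtain k where k: "k > 0" "L k w \<noteq> 0" using none unfolding good_def by blast
    have "L l (L k w) = 0" if l: "l \<ge> N" for l
    \<comment> \<open>\<open>L_commute\<close> says nothing when l + k = 0. That case is impossible:
      k < N \<le> l together with k > 0 makes the sum positive.\<close>
    proof (cases "l + k = 0")
      case True
      then have "L k w = 0" if "k \<ge> N" using w that by (simp add: good_def)
      then have "k < N" using k(2) by (meson not_less)
      then show ?thesis using True l k by linarith
    next
      case False
      then show ?thesis using L_commute[of l k w] w l k by (simp add: good_def)
    qed
    then have "good (j + k) (L k w)" using w k L_D by (simp add: good_def)
    then show ?thesis using k w by (auto simp: H_def intro!: exI[of _ "j + k"])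
  qed
  have iH: "i \<in> H" using v N by (auto simp: H_def good_def)
  have infH: "infinite H"
  proof
    assume fin: "finite H"
    then have "Max H \<in> H" using iH by (intro Max_in) auto
    then show False using up fin by (meson Max_ge not_less)
  qed
  have "\<exists>w m. w \<in> D j \<and> 0 < m \<and> m < N \<and> L m w \<noteq> 0 \<and> (\<forall>k>m. L k w = 0)" if j: "j \<in> H" for j
  proof -
    obtain w where w: "good j w" using j by (auto simp: H_def)
    define M where "M = {m. 0 < m \<and> m < N \<and> L m w \<noteq> 0}"
    have finM: "finite M" by (rule finite_subset[of _ "{0<..<N}"]) (auto simp: M_def)
    obtain k where k: "k > 0" "L k w \<noteq> 0" using w none unfolding good_def by blast
    moreover have "k < N" using k w unfolding good_def by (meson not_less)
    ultimately have "k \<in> M" by (simp add: M_def)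
    then have mM: "Max M \<in> M" using finM by (intro Max_in) auto
    have "L l w = 0" if l: "l > Max M" for l
    proof (rule ccontr)
      assume nz: "L l w \<noteq> 0"
      then have "l < N" using w unfolding good_def by (meson not_less)
      then have "l \<in> M" using nz l mM by (simp add: M_def)
      then show False using l finM by (meson Max_ge not_less)
    qed
    moreover have "0 < Max M \<and> Max M < N \<and> L (Max M) w \<noteq> 0" using mM unfolding M_def by blast
    moreover have "w \<in> D j" using w by (simp add: good_def)
    ultimately show ?thesis by blast
  qed
  then obtain w m where wm: "\<And>j. j \<in> H \<Longrightarrow> w j \<in> D j \<and> 0 < m j \<and> m j < N \<and> L (m j) (w j) \<noteq> 0 \<and>
      (\<forall>k>m j. L k (w j) = 0)"
    by metis
  \<comment> \<open>Pigeonhole on the last nonvanishing index and the residue modulo p gives an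
    infinite class with common \<open>m\<close> and congruent degrees.\<close>
  define f where "f j = (m j, j mod int p)" for j
  have "finite (f ` H)"
  proof (rule finite_subset)
    show "f ` H \<subseteq> {0<..<N} \<times> {0..<int p}" using wm p_pos by (auto simp: f_def)
  qed simp
  then obtain t where t: "t \<in> H" "infinite {j\<in>H. f j = f t}"
    using pigeonhole_infinite[OF infH] by blast
  define S where "S = {j\<in>H. f j = f t \<and> t < j}"
  have "finite S"
  proof (rule independent_degrees_finite[of "m t" S w t])
    show "m t > 0" using wm t by blast
    show "w j \<in> D j \<and> L (m t) (w j) \<noteq> 0 \<and> (\<forall>k>m t. L k (w j) = 0)" if "j \<in> S" for j
      using wm[of j] that by (auto simp: S_def f_def)
    show "t < j \<and> int p dvd t - j" if "j \<in> S" for j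
    proof -
      have "t mod int p = j mod int p" using that by (simp add: S_def f_def)
      then show ?thesis using that by (simp add: mod_eq_dvd_iff S_def)
    qed
  qed
  moreover have "{j\<in>H. f j = f t} \<subseteq> S \<union> {i..t}" by (auto simp: S_def H_def)
  ultimately show False using t(2) finite_subset by blast
qed

section \<open>Bounds on the dimensions\<close>

text \<open>The bound is the size of a set spanning all of \<open>D 0\<close>, ...,
  \<open>D (2 p - 1)\<close>, hence independent of i. In a larger \<open>D i\<close> the operators
  \<open>L (q - i)\<close>, 0 \<le> q < 2 p, share a nonzero kernel vector; their indices form a
  window starting at - i > 0, so \<open>annihilator_eventually\<close> applies.\<close>

lemma dim_bounded_below:
  assumes "\<not> (\<exists>i. \<exists>w\<in>D i. w \<noteq> 0 \<and> (\<forall>j>0. L j w = 0))"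
  shows "\<exists>K. \<forall>i<0. dim (D i) \<le> K"
proof -
  interpret pair: vector_space_pair scale scale by unfold_locales
  define Q where "Q = {0..<2 * int p}"
  obtain B where B: "\<And>i. finite (B i)" "\<And>i. D i \<subseteq> span (B i)"
    using fin_dim_D unfolding fin_dim_def by metis
  define B' where "B' = (\<Union>q\<in>Q. B q)"
  have B': "finite B'" using B(1) by (simp add: B'_def Q_def)
  have "dim (D i) \<le> card B'" if i: "i < 0" for i
  proof (rule ccontr)
    assume big: "\<not> dim (D i) \<le> card B'"
    obtain A where A: "A \<subseteq> D i" "independent A" "card A = dim (D i)"
      using basis_exists by metis
    \<comment> \<open>The summands lie in different degrees, so \<open>T v = 0\<close> kills each of them.\<close>
    define T where "T v = (\<Sum>q\<in>Q. L (q - i) v)" for v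
    have lin: "Vector_Spaces.linear scale scale T"
      by unfold_locales (simp_all add: T_def L_add L_scale sum.distrib scale_sum_right)
    have spanA: "span A \<subseteq> D i" using A(1) subspace_D by (rule span_minimal)
    have LQ: "L (q - i) v \<in> D q" if "v \<in> D i" for q v
      using L_D[OF that, of "q - i"] by simp
    have "\<not> inj_on T (span A)"
    proof
      assume inj: "inj_on T (span A)"
      have "T v \<in> span B'" if "v \<in> D i" for v
        unfolding T_def
      proof (rule span_sum)
        fix q assume "q \<in> Q"
        then have "span (B q) \<subseteq> span B'" by (intro span_mono) (auto simp: B'_def)
        then show "L (q - i) v \<in> span B'" using LQ[OF that] B(2) by blast
      qed
      then have "T ` A \<subseteq> span B'" using A(1) by blast
      moreover have "independent (T ` A)"
        using pair.linear_independent_injective_image[OF lin A(2) inj] .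
      ultimately have "card (T ` A) \<le> card B'" using independent_span_bound[OF B'] by blast
      moreover have "card (T ` A) = card A"
        using inj by (meson card_image inj_on_subset span_superset)
      ultimately show False using big A(3) by simp
    qed
    then obtain v where v: "v \<in> span A" "v \<noteq> 0" "T v = 0"
      using pair.linear_inj_on_iff_eq_0[OF lin subspace_span] by blast
    have vD: "v \<in> D i" using v spanA by blast
    have "L (- i + q) v = 0" if "0 \<le> q" "q < 2 * int p" for q
    proof -
      have "L (q - i) v = 0"
        using v(3) that LQ[OF vD] unfolding T_def
        by (intro D_independent[of Q "\<lambda>q. L (q - i) v" q]) (auto simp: Q_def)
      then show ?thesis by (simp add: algebra_simps)
    qed
    then obtain N where "\<And>j. j \<ge> N \<Longrightarrow> L j v = 0"
      using annihilator_eventually[of "- i" v] i by auto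
    then show False using exists_highest_weight_vector[OF vD v(2)] assms by blast
  qed
  then show ?thesis by blast
qed

text \<open>Sending L_n to -L_{-n} respects the brackets away from m + n = 0:
  \<open>gap_coeff\<close> changes sign when both arguments do, and the minus sign of the new
  operators compensates.\<close>

lemma reversed: "graded_gap_module scale p (\<lambda>i. D (- i)) (\<lambda>n v. - L (- n) v)"
proof
  show "p > 0" by (rule p_pos)
  show "- L (- n) (v + w) = - L (- n) v + - L (- n) w" for n v w by (simp add: L_add)
  show "- L (- n) (scale c v) = scale c (- L (- n) v)" for n c v by (simp add: L_scale)
  show "subspace (D (- i))" "fin_dim scale (D (- i))" for i
    by (rule subspace_D, rule fin_dim_D)
  show "- L (- n) v \<in> D (- (i + n))" if "v \<in> D (- i)" for i n v
    using subspace_neg[OF subspace_D L_D[OF that, of "- n"]] by simp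
  show "d i = 0" if "finite I" "\<And>i. i \<in> I \<Longrightarrow> d i \<in> D (- i)" "sum d I = 0" "i \<in> I" for I d i
  proof -
    have "(\<Sum>j\<in>uminus ` I. d (- j)) = 0"
      using that(3) by (subst sum.reindex) (auto simp: inj_on_def)
    then have "d (- (- i)) = 0"
      using that by (intro D_independent[of "uminus ` I" "\<lambda>j. d (- j)"]) auto
    then show ?thesis by simp
  qed
  have neg: "L n (- v) = - L n v" for n v
    using L_scale[of n "- 1" v] by simp
  show "- L (- m) (- L (- n) v) = - L (- n) (- L (- m) v) +
      scale (of_int (gap_coeff p m n)) (- L (- (m + n)) v)" if "m + n \<noteq> 0" for m n v
  proof -
    have "gap_coeff p (- m) (- n) = - gap_coeff p m n" by (simp add: gap_coeff_def)
    then show ?thesis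
      using L_commute[of "- m" "- n" v] that by (simp add: neg)
  qed
qed

lemma dim_bounded:
  assumes "\<not> (\<exists>i. \<exists>w\<in>D i. w \<noteq> 0 \<and> (\<forall>j>0. L j w = 0))"
    and "\<not> (\<exists>i. \<exists>w\<in>D i. w \<noteq> 0 \<and> (\<forall>j<0. L j w = 0))"
  shows "\<exists>K. \<forall>i. dim (D i) \<le> K"
proof -
  interpret R: graded_gap_module scale p "\<lambda>i. D (- i)" "\<lambda>n v. - L (- n) v" by (rule reversed)
  obtain K1 where K1: "\<forall>i<0. dim (D i) \<le> K1" using dim_bounded_below[OF assms(1)] by blast
  have "\<not> (\<exists>i. \<exists>w\<in>D (- i). w \<noteq> 0 \<and> (\<forall>j>0. - L (- j) w = 0))"
  proof clarify
    fix i w assume w: "w \<in> D (- i)" "w \<noteq> 0" "\<forall>j>0. - L (- j) w = 0"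
    have "L j w = 0" if "j < 0" for j using w(3)[rule_format, of "- j"] that by simp
    then show False using assms(2) w by blast
  qed
  then obtain K2 where K2: "\<forall>i<0. dim (D (- i)) \<le> K2" using R.dim_bounded_below by blast
  \<comment> \<open>Degree 0 belongs to neither half and enters the maximum separately.\<close>
  have "dim (D i) \<le> max (max K1 K2) (dim (D 0))" for i
    using K1[rule_format, of i] K2[rule_format, of "- i"] by (cases i "0::int" rule: linorder_cases) auto
  then show ?thesis by blast
qed

end

section \<open>Weights and their shifts\<close>

text \<open>A vanishing sum, extended by zero, and the zero family both decompose 0, so uniqueness
  of decompositions identifies them.\<close>

lemma internal_direct_sum_independent:
  assumes "internal_direct_sum I W" "\<And>i. i \<in> I \<Longrightarrow> 0 \<in> W i"
    and "finite J" "J \<subseteq> I" "\<And>j. j \<in> J \<Longrightarrow> d j \<in> W j" "(\<Sum>j\<in>J. d j) = 0" "j \<in> J"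
  shows "d j = 0"
proof -
  define f where "f i = (if i \<in> J then d i else 0)" for i
  define P where "P g \<longleftrightarrow> (\<forall>i\<in>I. g i \<in> W i) \<and> (\<forall>i. i \<notin> I \<longrightarrow> g i = 0) \<and>
    finite {i. g i \<noteq> 0} \<and> 0 = (\<Sum>i\<in>{i. g i \<noteq> 0}. g i)" for g
  have supp: "{i. f i \<noteq> 0} \<subseteq> J" by (auto simp: f_def)
  have "(\<Sum>i\<in>{i. f i \<noteq> 0}. f i) = (\<Sum>i\<in>J. f i)"
    by (rule sum.mono_neutral_left) (use assms(3) supp in auto)
  also have "\<dots> = 0" using assms(6) by (simp add: f_def)
  finally have "P f" using assms finite_subset[OF supp] by (auto simp: P_def f_def)
  moreover have "P (\<lambda>_. 0)" using assms(2) by (simp add: P_def)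
  moreover have "\<exists>!g. P g"
    using assms(1) unfolding internal_direct_sum_def P_def by (rule spec)
  ultimately have "f = (\<lambda>_. 0)" by (metis the1_equality)
  then show ?thesis using assms(7) by (metis f_def)
qed

text \<open>This is \<mu> plus n times the functional taking the coefficient of L_0, which vanishes
  on the central elements. Restricting keeps it extensional, hence inside
  \<open>gv_zero_dual p\<close>.\<close>

definition gv_shift :: "nat \<Rightarrow> (gv \<Rightarrow> complex) \<Rightarrow> int \<Rightarrow> gv \<Rightarrow> complex"
  where "gv_shift p \<mu> n =
    restrict (\<lambda>a. \<mu> a + of_int n * Poly_Mapping.lookup a (L_idx 0)) (gv_zero p)"

lemma gvL_0_in_zero [simp]: "gvL 0 \<in> gv_zero p"
  and gvC_in_zero [simp]: "i < p \<Longrightarrow> gvC p i \<in> gv_zero p"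
  unfolding gv_zero_def by (auto intro: gv.span_base)

lemma lookup_gvL_0: "Poly_Mapping.lookup (gvL 0) (L_idx 0) = 1"
  by (simp add: gvL_def)

lemma lookup_gvC_L: "Poly_Mapping.lookup (gvC p i) (L_idx n) = 0"
  by (simp add: gvC_def lookup_single)

lemma gv_zero_subset: "gv_zero p \<subseteq> gap_virasoro p"
  unfolding gv_zero_def gap_virasoro_def by (intro gv.span_mono) auto

lemma gv_shift_in_dual: "\<mu> \<in> gv_zero_dual p \<Longrightarrow> gv_shift p \<mu> n \<in> gv_zero_dual p"
  using gv.span_add gv.span_scale unfolding gv_zero_dual_def gv_shift_def gv_zero_def
  by (auto simp: lookup_add algebra_simps)

lemma gv_shift_0: "\<mu> \<in> gv_zero_dual p \<Longrightarrow> gv_shift p \<mu> 0 = \<mu>"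
  by (simp add: gv_shift_def gv_zero_dual_def extensional_restrict)

lemma gv_shift_eq_iff: "gv_shift p \<mu> m = gv_shift p \<mu> n \<longleftrightarrow> m = n"
proof
  assume "gv_shift p \<mu> m = gv_shift p \<mu> n"
  then have "gv_shift p \<mu> m (gvL 0) = gv_shift p \<mu> n (gvL 0)" by simp
  then show "m = n" by (simp add: gv_shift_def lookup_gvL_0)
qed simp

text \<open>By linearity in \<open>a\<close> only L_0 and the central elements matter. L_0 has
  eigenvalue n on L_n whether or not p divides n.\<close>

lemma gv_bracket_zero_L:
  assumes "a \<in> gv_zero p"
  shows "gv_bracket p a (gvL n) = gv_scale (of_int n * Poly_Mapping.lookup a (L_idx 0)) (gvL n)"
proof -
  let ?S = "{a. gv_bracket p a (gvL n) =
    gv_scale (of_int n * Poly_Mapping.lookup a (L_idx 0)) (gvL n)}"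
  have "gv.subspace ?S"
    by (auto simp: gv.subspace_def gv_bilinear lookup_add distrib_left gv.scale_left_distrib
        mult.left_commute)
  moreover have "gvL 0 \<in> ?S"
    by (cases "int p dvd n") (auto simp: gv_bracket_L lookup_gvL_0)
  moreover have "gvC p i \<in> ?S" for i
    by (simp add: lookup_gvC_L)
  ultimately have "gv_zero p \<subseteq> ?S"
    unfolding gv_zero_def by (intro gv.span_minimal) auto
  then show ?thesis using assms by blast
qed

section \<open>The grading of an irreducible module by weights\<close>

context
  fixes p :: nat
    and vscale :: "complex \<Rightarrow> 'v::ab_group_add \<Rightarrow> 'v"
    and act :: "gv \<Rightarrow> 'v \<Rightarrow> 'v"
  assumes p: "p > 1" and gv_mod: "gv_module p vscale act"
begin

interpretation M: lie_module gv_scale "gap_virasoro p" "gv_bracket p" vscale act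
  by (rule gv_mod)

lemma act_zero_right: "x \<in> gap_virasoro p \<Longrightarrow> act x 0 = 0"
  using M.act_scale_right[of x 0 0] by simp

lemma act_zero_left: "act 0 v = 0"
  using M.act_scale_left[of "gvL 0" 0 v] by simp

lemma subspace_weight_space: "M.V.subspace (weight_space p vscale act \<mu>)"
  using gv_zero_subset unfolding M.V.subspace_def weight_space_def
  by (auto simp: subset_iff act_zero_right M.act_add_right M.act_scale_right
      M.V.scale_right_distrib mult.commute)

lemma act_weight_space:
  assumes "v \<in> weight_space p vscale act (gv_shift p \<mu> i)"
  shows "act (gvL n) v \<in> weight_space p vscale act (gv_shift p \<mu> (i + n))"
  unfolding weight_space_def
proof safe
  fix a assume a: "a \<in> gv_zero p"
  then have aG: "a \<in> gap_virasoro p" using gv_zero_subset by auto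
  have "act a (act (gvL n) v) = act (gv_bracket p a (gvL n)) v + act (gvL n) (act a v)"
    using M.act_br[OF aG, of "gvL n" v] by simp
  also have "\<dots> = vscale (gv_shift p \<mu> (i + n) a) (act (gvL n) v)"
    using assms a unfolding weight_space_def gv_bracket_zero_L[OF a]
    by (simp add: M.act_scale_left M.act_scale_right gv_shift_def algebra_simps
        flip: M.V.scale_left_distrib)
  finally show "act a (act (gvL n) v) = vscale (gv_shift p \<mu> (i + n) a) (act (gvL n) v)" .
qed

lemma shifted_weight_spaces_submodule:
  "lie_submodule (gap_virasoro p) vscale act
    (M.V.span (\<Union>i. weight_space p vscale act (gv_shift p \<mu> i)))" (is "lie_submodule _ _ _ (M.V.span ?D)")
proof -
  have lift: "act x v \<in> M.V.span ?D"
    if x: "x \<in> gap_virasoro p" and v: "v \<in> M.V.span ?D"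
      and D: "\<And>v. v \<in> ?D \<Longrightarrow> act x v \<in> M.V.span ?D" for x v
  proof -
    have "M.V.subspace {v. act x v \<in> M.V.span ?D}"
      using x by (auto simp: M.V.subspace_def act_zero_right M.act_add_right M.act_scale_right
          intro: M.V.span_add M.V.span_scale M.V.span_zero)
    then show ?thesis using v D by (auto elim!: M.V.span_induct)
  qed
  have "\<forall>v\<in>M.V.span ?D. act x v \<in> M.V.span ?D" if x: "x \<in> gap_virasoro p" for x
  proof -
    \<comment> \<open>Membership is carried along because \<open>act\<close> is known to be linear
      in its first argument only on \<open>gap_virasoro p\<close>.\<close>
    have "x \<in> gap_virasoro p \<and> (\<forall>v\<in>M.V.span ?D. act x v \<in> M.V.span ?D)"
      using x
    proof (induction rule: gap_virasoro_induct)
      case (L m)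
      have "act (gvL m) v \<in> M.V.span ?D" if "v \<in> ?D" for v
        using that act_weight_space by (blast intro: M.V.span_base)
      then show ?case using lift[of "gvL m"] by simp
    next
      case (C i)
      have "act (gvC p i) v \<in> M.V.span ?D" if v: "v \<in> ?D" for v
      proof -
        obtain n where "v \<in> weight_space p vscale act (gv_shift p \<mu> n)" using v by blast
        then have "act (gvC p i) v = vscale (gv_shift p \<mu> n (gvC p i)) v"
          using C by (simp add: weight_space_def)
        then show ?thesis using M.V.span_scale[OF M.V.span_base[OF v]] by simp
      qed
      then show ?case using lift[of "gvC p i"] C by simp
    qed (auto simp: act_zero_left M.act_add_left M.act_scale_left M.V.span_zero
        gv.subspace_0[OF gv_subspace]
        intro: M.V.span_add M.V.span_scale gv.subspace_add[OF gv_subspace]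
          gv.subspace_scale[OF gv_subspace])
    then show ?thesis by blast
  qed
  then show ?thesis unfolding lie_submodule_def using M.V.subspace_span by blast
qed

lemma span_shifted_weight_spaces:
  assumes "v \<in> M.V.span (\<Union>i. weight_space p vscale act (gv_shift p \<mu> i))"
  obtains I d where "finite (I :: int set)" "\<And>i. d i \<in> weight_space p vscale act (gv_shift p \<mu> i)"
    "v = (\<Sum>i\<in>I. d i)"
proof -
  let ?W = "\<lambda>i. weight_space p vscale act (gv_shift p \<mu> i)"
  \<comment> \<open>Extending \<open>d\<close> by zero outside \<open>I\<close> lets two
    decompositions be added over the union of their index sets.\<close>
  define P where "P v I d \<longleftrightarrow> finite (I :: int set) \<and> (\<forall>i. d i \<in> ?W i) \<and>
    (\<forall>i. i \<notin> I \<longrightarrow> d i = 0) \<and> v = (\<Sum>i\<in>I. d i)" for v I d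
  note sub = subspace_weight_space
  have "M.V.subspace {v. \<exists>I d. P v I d}"
    unfolding M.V.subspace_def
  proof (intro conjI ballI allI)
    have "P 0 {} (\<lambda>_. 0)" using M.V.subspace_0[OF sub] by (simp add: P_def)
    then show "0 \<in> {v. \<exists>I d. P v I d}" by blast
  next
    fix v w assume "v \<in> {v. \<exists>I d. P v I d}" "w \<in> {v. \<exists>I d. P v I d}"
    then obtain I d J e where d: "P v I d" and e: "P w J e" by blast
    have "v = (\<Sum>i\<in>I \<union> J. d i)" "w = (\<Sum>i\<in>I \<union> J. e i)"
      using d e unfolding P_def by (auto intro!: sum.mono_neutral_left)
    then have "P (v + w) (I \<union> J) (\<lambda>i. d i + e i)"
      using d e M.V.subspace_add[OF sub] by (simp add: P_def sum.distrib)
    then show "v + w \<in> {v. \<exists>I d. P v I d}" by blast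
  next
    fix c v assume "v \<in> {v. \<exists>I d. P v I d}"
    then obtain I d where d: "P v I d" by blast
    have "P (vscale c v) I (\<lambda>i. vscale c (d i))"
      using d M.V.subspace_scale[OF sub] by (simp add: P_def M.V.scale_sum_right)
    then show "vscale c v \<in> {v. \<exists>I d. P v I d}" by blast
  qed
  moreover have "v \<in> {v. \<exists>I d. P v I d}" if "v \<in> ?W i" for v i
  proof -
    have "P v {i} (\<lambda>j. if j = i then v else 0)"
      using that M.V.subspace_0[OF sub] by (simp add: P_def)
    then show ?thesis by blast
  qed
  then have "(\<Union>i. ?W i) \<subseteq> {v. \<exists>I d. P v I d}" by blast
  ultimately have "M.V.span (\<Union>i. ?W i) \<subseteq> {v. \<exists>I d. P v I d}" by (intro M.V.span_minimal)
  then obtain I d where "P v I d" using assms by blast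
  then show ?thesis using that[of I d] by (simp add: P_def)
qed

text \<open>A nonzero weight component of any vector lies in the submodule spanned by the weight
  spaces of its coset, which is therefore everything. A vector of weight outside the coset would
  then contradict directness of the sum.\<close>

lemma weights_in_one_coset:
  assumes irr: "lie_irreducible (gap_virasoro p) vscale act"
    and wm: "weight_module p vscale act"
  obtains \<mu> where "\<mu> \<in> gv_zero_dual p" "weights p vscale act \<subseteq> range (gv_shift p \<mu>)"
proof -
  let ?W = "weight_space p vscale act"
  have ds: "internal_direct_sum (gv_zero_dual p) ?W"
    using wm by (simp add: weight_module_def)
  obtain v :: 'v where v: "v \<noteq> 0" using irr unfolding lie_irreducible_def by blast
  obtain f where f: "\<forall>\<nu>\<in>gv_zero_dual p. f \<nu> \<in> ?W \<nu>" "\<forall>\<nu>. \<nu> \<notin> gv_zero_dual p \<longrightarrow> f \<nu> = 0"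
      "v = (\<Sum>\<nu>\<in>{\<nu>. f \<nu> \<noteq> 0}. f \<nu>)"
    using ds unfolding internal_direct_sum_def by metis
  have "{\<nu>. f \<nu> \<noteq> 0} \<noteq> {}" using f(3) v by (metis sum.empty)
  then obtain \<mu> where \<mu>: "f \<mu> \<noteq> 0" by blast
  then have \<mu>D: "\<mu> \<in> gv_zero_dual p" using f(2) by blast
  let ?U = "M.V.span (\<Union>i. ?W (gv_shift p \<mu> i))"
  have "f \<mu> \<in> ?W (gv_shift p \<mu> 0)" using f(1) \<mu>D gv_shift_0 by simp
  then have "f \<mu> \<in> ?U" by (blast intro: M.V.span_base)
  then have U: "?U = UNIV"
    using irr shifted_weight_spaces_submodule[of \<mu>] \<mu> unfolding lie_irreducible_def by blast
  have "\<nu> \<in> range (gv_shift p \<mu>)" if \<nu>: "\<nu> \<in> weights p vscale act" for \<nu>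
  proof (rule ccontr)
    assume nr: "\<nu> \<notin> range (gv_shift p \<mu>)"
    have \<nu>D: "\<nu> \<in> gv_zero_dual p" "?W \<nu> \<noteq> {0}" using \<nu> by (auto simp: weights_def)
    then obtain w where w: "w \<in> ?W \<nu>" "w \<noteq> 0"
      using M.V.subspace_0[OF subspace_weight_space] by blast
    obtain I d where d: "finite I" "\<And>i. d i \<in> ?W (gv_shift p \<mu> i)" "w = (\<Sum>i\<in>I. d i)"
      using span_shifted_weight_spaces[of w \<mu>] U by blast
    \<comment> \<open>This indexes the relation - w + sum of the \<open>d i\<close> = 0 by weights;
      the inverse is harmless since \<open>gv_shift p\<close> \<mu> is injective.\<close>
    define e where "e \<kappa> = (if \<kappa> = \<nu> then - w else d (inv (gv_shift p \<mu>) \<kappa>))" for \<kappa>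
    have inj: "inj (gv_shift p \<mu>)" by (rule injI) (simp add: gv_shift_eq_iff)
    have e: "e (gv_shift p \<mu> i) = d i" for i
      using nr inj by (auto simp: e_def)
    have "(\<Sum>\<kappa>\<in>insert \<nu> (gv_shift p \<mu> ` I). e \<kappa>) = - w + (\<Sum>i\<in>I. d i)"
      using d(1) nr by (subst sum.insert)
        (auto simp: e sum.reindex inj_on_subset[OF inj] e_def[of \<nu>])
    then have sum0: "(\<Sum>\<kappa>\<in>insert \<nu> (gv_shift p \<mu> ` I). e \<kappa>) = 0" using d(3) by simp
    have "e \<kappa> \<in> ?W \<kappa>" if \<kappa>: "\<kappa> \<in> insert \<nu> (gv_shift p \<mu> ` I)" for \<kappa>
    proof (cases "\<kappa> = \<nu>")
      case True
      then show ?thesis using M.V.subspace_neg[OF subspace_weight_space w(1)] by (simp add: e_def)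
    next
      case False
      then obtain i where "\<kappa> = gv_shift p \<mu> i" using \<kappa> by blast
      then show ?thesis using e d(2) by simp
    qed
    then have "e \<nu> = 0"
      using internal_direct_sum_independent[OF ds M.V.subspace_0[OF subspace_weight_space] _ _ _ sum0]
        d(1) \<nu>D(1) gv_shift_in_dual[OF \<mu>D] by blast
    then show False using w by (simp add: e_def)
  qed
  then show ?thesis using that[OF \<mu>D] by blast
qed

lemma graded_gap_module_shifted_weight_spaces:
  assumes hc: "harish_chandra p vscale act" and \<mu>: "\<mu> \<in> gv_zero_dual p"
  shows "graded_gap_module vscale p (\<lambda>i. weight_space p vscale act (gv_shift p \<mu> i)) (\<lambda>n. act (gvL n))"
proof
  let ?W = "\<lambda>i. weight_space p vscale act (gv_shift p \<mu> i)"
  show "p > 0" using p by simp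
  show "act (gvL n) (v + w) = act (gvL n) v + act (gvL n) w"
    "act (gvL n) (vscale c v) = vscale c (act (gvL n) v)" for n v w c
    by (simp_all add: M.act_add_right M.act_scale_right)
  show "M.V.subspace (?W i)" for i by (rule subspace_weight_space)
  show "act (gvL n) v \<in> ?W (i + n)" if "v \<in> ?W i" for v i n
    using that by (rule act_weight_space)
  show "fin_dim vscale (?W i)" for i
  \<comment> \<open>Finite dimension is assumed only at actual weights, so shifts with zero weight
    space are treated apart.\<close>
  proof (cases "?W i = {0}")
    case True
    then show ?thesis unfolding fin_dim_def by (intro exI[of _ "{}"]) simp
  next
    case False
    then show ?thesis
      using hc gv_shift_in_dual[OF \<mu>] by (simp add: harish_chandra_def weights_def)
  qed
  show "d i = 0" if "finite I" "\<And>i. i \<in> I \<Longrightarrow> d i \<in> ?W i" "sum d I = 0" "i \<in> I" for I d i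
  proof -
    have inj: "inj (gv_shift p \<mu>)" by (rule injI) (simp add: gv_shift_eq_iff)
    have ds: "internal_direct_sum (gv_zero_dual p) (weight_space p vscale act)"
      using hc by (simp add: harish_chandra_def weight_module_def)
    have "d (inv (gv_shift p \<mu>) (gv_shift p \<mu> i)) = 0"
      using that M.V.subspace_0[OF subspace_weight_space] inj
      by (intro internal_direct_sum_independent[OF ds, of "gv_shift p \<mu> ` I"
            "\<lambda>\<nu>. d (inv (gv_shift p \<mu>) \<nu>)"])
        (auto simp: gv_shift_in_dual[OF \<mu>] sum.reindex inj_on_subset[OF inj])
    then show ?thesis using inj by simp
  qed
  show "act (gvL m) (act (gvL n) v) = act (gvL n) (act (gvL m) v) +
      vscale (of_int (gap_coeff p m n)) (act (gvL (m + n)) v)" if "m + n \<noteq> 0" for m n v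
  proof -
    have "gv_bracket p (gvL m) (gvL n) = gv_scale (of_int (gap_coeff p m n)) (gvL (m + n))"
      using that by (auto simp: gap_coeff_def gv_bracket_L)
    then show ?thesis
      using M.act_br[of "gvL m" "gvL n" v] by (simp add: M.act_scale_left algebra_simps)
  qed
qed

text \<open>Passes from the generators L_j with j > 0 or j < 0 to all of \<open>gv_plus\<close> or
  \<open>gv_minus\<close>.\<close>

lemma act_span_eq_0:
  assumes "S \<subseteq> gap_virasoro p" "\<And>x. x \<in> S \<Longrightarrow> act x v = 0" "x \<in> gv.span S"
  shows "act x v = 0"
proof -
  have "gv.subspace {x \<in> gap_virasoro p. act x v = 0}"
    by (auto simp: gv.subspace_def act_zero_left M.act_add_left M.act_scale_left
        gv.subspace_0[OF gv_subspace] gv.subspace_add[OF gv_subspace]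
        gv.subspace_scale[OF gv_subspace])
  then have "gv.span S \<subseteq> {x \<in> gap_virasoro p. act x v = 0}"
    using assms by (intro gv.span_minimal) auto
  then show ?thesis using assms(3) by blast
qed

lemma irreducible_generated_by:
  "lie_irreducible (gap_virasoro p) vscale act \<Longrightarrow> v \<noteq> 0 \<Longrightarrow>
    lie_generated_by (gap_virasoro p) vscale act v"
  unfolding lie_irreducible_def lie_generated_by_def by blast

end

theorem theorem2p2:
  fixes p :: nat
    and vscale :: "complex \<Rightarrow> 'v::ab_group_add \<Rightarrow> 'v"
    and act :: "gv \<Rightarrow> 'v \<Rightarrow> 'v"
  assumes "p > 1"
    and "gv_module p vscale act"
    and "lie_irreducible (gap_virasoro p) vscale act"
    and "harish_chandra p vscale act"
  shows "highest_weight_module p vscale act \<or> lowest_weight_module p vscale act \<or>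
    cuspidal p vscale act"
proof -
  have wm: "weight_module p vscale act" using assms(4) by (simp add: harish_chandra_def)
  obtain \<mu> where \<mu>: "\<mu> \<in> gv_zero_dual p" "weights p vscale act \<subseteq> range (gv_shift p \<mu>)"
    using weights_in_one_coset[OF assms(1-3) wm] by blast
  let ?W = "\<lambda>i. weight_space p vscale act (gv_shift p \<mu> i)"
  interpret D: graded_gap_module vscale p ?W "\<lambda>n. act (gvL n)"
    using graded_gap_module_shifted_weight_spaces[OF assms(1,2,4) \<mu>(1)] .
  note dual = gv_shift_in_dual[OF \<mu>(1)]
  note generated = irreducible_generated_by[OF assms(1-3)]
  consider (highest) i w where "w \<in> ?W i" "w \<noteq> 0" "\<forall>j>0. act (gvL j) w = 0"
    | (lowest) i w where "w \<in> ?W i" "w \<noteq> 0" "\<forall>j<0. act (gvL j) w = 0"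
    | (bounded) K where "\<forall>i. D.dim (?W i) \<le> K"
    using D.dim_bounded by blast
  then show ?thesis
  proof cases
    case highest
    then have "act x w = 0" if "x \<in> gv_plus" for x
      using that unfolding gv_plus_def by (rule_tac act_span_eq_0[OF assms(1,2)]) auto
    then have "highest_weight_module p vscale act"
      unfolding highest_weight_module_def using highest wm dual generated by blast
    then show ?thesis by blast
  next
    case lowest
    then have "act x w = 0" if "x \<in> gv_minus" for x
      using that unfolding gv_minus_def by (rule_tac act_span_eq_0[OF assms(1,2)]) auto
    then have "lowest_weight_module p vscale act"
      unfolding lowest_weight_module_def using lowest wm dual generated by blast
    then show ?thesis by blast
  next
    case bounded
    \<comment> \<open>Every weight is a shift of \<mu>, so the bound on the graded pieces covers it;
      \<open>Suc K\<close> makes the bound strict and positive.\<close>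
    have "fin_dim vscale (weight_space p vscale act \<nu>) \<and>
        D.dim (weight_space p vscale act \<nu>) < Suc K" if \<nu>: "\<nu> \<in> weights p vscale act" for \<nu>
    proof -
      obtain i where "\<nu> = gv_shift p \<mu> i" using \<mu>(2) \<nu> by blast
      then show ?thesis using bounded D.fin_dim_D by (simp add: less_Suc_eq_le)
    qed
    then have "cuspidal p vscale act"
      unfolding cuspidal_def using wm by blast
    then show ?thesis by blast
  qed
qed

end
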